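(* Let $f,h,w$ be positive integers, $N=fhw$, let $F\in\mathbb{C}^{N\times N}$ be the three-dimensional DFT matrix of size $(f,h,w)$, and write $F=A+iB$ with $A=\Re(F)$, $B=\Im(F)$. Let $\Lambda$ be a real diagonal $N\times N$ matrix with all diagonal entries in $[0,1]$. Let $x,y$ be independent random vectors in $\mathbb{R}^N$, each distributed as $\mathcal{N}(0,I)$, and let $$z=\Re\left(F^{-1}\Lambda F x+F^{-1}(I-\Lambda)F y\right).$$ Then $$z\sim\mathcal{N}\left(0,\ P^2+(I-P)^2\right),\qquad P=\frac1N\left(A\Lambda A+B\Lambda B\right).$$
   Context: The (one-dimensional) DFT matrix of size $n$ is $F_n=\left(\omega_n^{(m-1)(k-1)}\right)_{1\le m,k\le n}$ with $\omega_n=e^{-2\pi i/n}$. The three-dimensional DFT matrix of size $(f,h,w)$ is the Kronecker product $F=F_f\otimes F_h\otimes F_w\in\mathbb{C}^{N\times N}$, $N=fhw$; its inverse is $F^{-1}=\frac1N F^\ast$. $\Re$ and $\Im$ denote entrywise real and imaginary parts. $\mathcal{N}(\mu,\Sigma)$ denotes the (possibly degenerate) Gaussian distribution with mean $\mu$ and covariance matrix $\Sigma$. *)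

theory Defs
  imports
    "HOL-Probability.Probability"
    "Jordan_Normal_Form.Gauss_Jordan_Elimination"
begin

text \<open>The analysis library also has types and constants called \<open>vec\<close> and \<open>mat\<close>; the ones meant
  here are those of \<open>Jordan_Normal_Form.Matrix\<close>, whose dimensions are terms. All indices start
  at 0.\<close>

definition dft_root :: "nat \<Rightarrow> complex" where
  "dft_root n = exp (- (2 * complex_of_real pi * \<i> / of_nat n))"

definition dft_mat :: "nat \<Rightarrow> complex Matrix.mat" where
  "dft_mat n = Matrix.mat n n (\<lambda>(m, k). dft_root n ^ (m * k))"

definition kronecker :: "'a::times Matrix.mat \<Rightarrow> 'a Matrix.mat \<Rightarrow> 'a Matrix.mat"
    (infixl \<open>\<otimes>\<^sub>K\<close> 70) where
  "A \<otimes>\<^sub>K B = Matrix.mat (dim_row A * dim_row B) (dim_col A * dim_col B)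
     (\<lambda>(i, j). A $$ (i div dim_row B, j div dim_col B) * B $$ (i mod dim_row B, j mod dim_col B))"

definition dft3_mat :: "nat \<Rightarrow> nat \<Rightarrow> nat \<Rightarrow> complex Matrix.mat" where
  "dft3_mat f h w = dft_mat f \<otimes>\<^sub>K dft_mat h \<otimes>\<^sub>K dft_mat w"

text \<open>\<open>mat_inverse\<close> returns \<open>None\<close> exactly on the matrices without a two-sided inverse; on those
  \<open>mat_inv\<close> is unspecified.\<close>

definition mat_inv :: "'a::field Matrix.mat \<Rightarrow> 'a Matrix.mat" where
  "mat_inv A = the (mat_inverse A)"

text \<open>\<open>\<real>\<^sup>n\<close>, the vectors of dimension \<open>n\<close>, with its Borel sets: the initial \<open>\<sigma>\<close>-algebra of the
  bijection onto the finite product of \<open>n\<close> copies of the real line.\<close>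

definition vec_borel :: "nat \<Rightarrow> real Matrix.vec measure" where
  "vec_borel n = vimage_algebra (carrier_vec n) (\<lambda>v. \<lambda>i\<in>{..<n}. v $ i)
     (\<Pi>\<^sub>M i\<in>{..<n}. (borel :: real measure))"

text \<open>One-dimensional Gaussian laws, point masses included.\<close>

definition gaussian_real :: "real measure \<Rightarrow> bool" where
  "gaussian_real \<nu> \<longleftrightarrow>
     (\<exists>m s. s > 0 \<and> \<nu> = density lborel (\<lambda>t. ennreal (normal_density m s t))) \<or>
     (\<exists>m. \<nu> = return borel m)"

text \<open>A law on \<open>\<real>\<^sup>n\<close> is (possibly degenerate) Gaussian if all linear functionals of it are. This
  makes the coordinates square integrable, so that the integrals for mean and covariance below
  are never those of a non-integrable function.\<close>

definition gaussian_vec :: "nat \<Rightarrow> real Matrix.vec measure \<Rightarrow> bool" where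
  "gaussian_vec n \<nu> \<longleftrightarrow> prob_space \<nu> \<and> sets \<nu> = sets (vec_borel n) \<and>
     (\<forall>t\<in>carrier_vec n. gaussian_real (distr \<nu> borel (\<lambda>v. t \<bullet> v)))"

definition mean_vec :: "nat \<Rightarrow> real Matrix.vec measure \<Rightarrow> real Matrix.vec" where
  "mean_vec n \<nu> = Matrix.vec n (\<lambda>i. \<integral>v. v $ i \<partial>\<nu>)"

definition cov_mat :: "nat \<Rightarrow> real Matrix.vec measure \<Rightarrow> real Matrix.mat" where
  "cov_mat n \<nu> = Matrix.mat n n
     (\<lambda>(i, j). \<integral>v. (v $ i - mean_vec n \<nu> $ i) * (v $ j - mean_vec n \<nu> $ j) \<partial>\<nu>)"

definition normal_distributed ::
  "nat \<Rightarrow> 's measure \<Rightarrow> ('s \<Rightarrow> real Matrix.vec) \<Rightarrow> real Matrix.vec \<Rightarrow> real Matrix.mat \<Rightarrow> bool" where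
  "normal_distributed n M X \<mu> \<Sigma> \<longleftrightarrow>
     X \<in> measurable M (vec_borel n) \<and>
     gaussian_vec n (distr M (vec_borel n) X) \<and>
     mean_vec n (distr M (vec_borel n) X) = \<mu> \<and>
     cov_mat n (distr M (vec_borel n) X) = \<Sigma>"

abbreviation cmat :: "real Matrix.mat \<Rightarrow> complex Matrix.mat" where
  "cmat \<equiv> map_mat complex_of_real"

abbreviation cvec :: "real Matrix.vec \<Rightarrow> complex Matrix.vec" where
  "cvec \<equiv> map_vec complex_of_real"

end

theory Submission
  imports Defs "Jordan_Normal_Form.Determinant"
begin

text \<open>The matrix \<open>F\<close> is symmetric and \<open>F * cnj F = N I\<close>, so \<open>F\<^sup>-\<^sup>1 = (A - iB) / N\<close> and the real part of
  \<open>F\<^sup>-\<^sup>1 \<Lambda> F\<close> is \<open>P\<close>, while that of \<open>F\<^sup>-\<^sup>1 (I - \<Lambda>) F\<close> is \<open>I - P\<close>. As \<open>x\<close> and \<open>y\<close> are real,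
  \<open>z = P x + (I - P) y\<close>, a sum of independent linear images of Gaussian vectors, with covariance
  \<open>P P\<^sup>T + (I - P) (I - P)\<^sup>T\<close>; and \<open>P\<close> is symmetric.\<close>

section \<open>Discrete Fourier matrices\<close>

lemma sum_div_mod:
  fixes f :: "nat \<Rightarrow> nat \<Rightarrow> 'a::comm_monoid_add"
  shows "(\<Sum>l<a * b. f (l div b) (l mod b)) = (\<Sum>u<a. \<Sum>v<b. f u v)"
proof -
  \<comment> \<open>The range below \<open>a * b\<close> is cut into \<open>a\<close> consecutive
    blocks of length \<open>b\<close>. On block \<open>u\<close> the quotient is constantly
    \<open>u\<close> and the remainder runs through the numbers below \<open>b\<close>.\<close>
  have "(\<Sum>l<a * b. f (l div b) (l mod b)) =
      (\<Sum>u<a. \<Sum>l\<in>{u * b..<u * b + b}. f (l div b) (l mod b))"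
    by (rule sum.nat_group[symmetric])
  also have "\<dots> = (\<Sum>u<a. \<Sum>v<b. f u v)"
  proof (rule sum.cong[OF refl])
    fix u
    show "(\<Sum>l\<in>{u * b..<u * b + b}. f (l div b) (l mod b)) = (\<Sum>v<b. f u v)"
      by (rule sum.reindex_bij_witness[of _ "\<lambda>v. u * b + v" "\<lambda>l. l - u * b"])
        (auto simp: div_nat_eqI minus_mult_div_eq_mod[symmetric] mult.commute[of b])
  qed
  finally show ?thesis .
qed

lemma kronecker_carrier:
  "A \<in> carrier_mat m n \<Longrightarrow> B \<in> carrier_mat p q \<Longrightarrow> A \<otimes>\<^sub>K B \<in> carrier_mat (m * p) (n * q)"
  by (auto simp: kronecker_def)

lemma div_mod_less:
  fixes i m n :: nat
  assumes "i < m * n"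
  shows "i div n < m" "i mod n < n"
  using assms less_mult_imp_div_less[OF assms] by (auto intro!: mod_less_divisor gr0I)

text \<open>Mixed product property. The summation index \<open>l < n * n'\<close> encodes the pair
  \<open>(l div n', l mod n')\<close>, so the sum becomes a double sum over both digits, which
  factors into the two matrix products.\<close>

lemma kronecker_mult:
  fixes A B C D :: "'a::comm_semiring_0 Matrix.mat"
  assumes A: "A \<in> carrier_mat m n" and C: "C \<in> carrier_mat n p"
    and B: "B \<in> carrier_mat m' n'" and D: "D \<in> carrier_mat n' p'"
  shows "(A \<otimes>\<^sub>K B) * (C \<otimes>\<^sub>K D) = (A * C) \<otimes>\<^sub>K (B * D)"
proof (rule eq_matI)
  fix i j assume "i < dim_row ((A * C) \<otimes>\<^sub>K (B * D))" "j < dim_col ((A * C) \<otimes>\<^sub>K (B * D))"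
  then have i: "i < m * m'" and j: "j < p * p'"
    using assms by (auto simp: kronecker_def)
  note ij = div_mod_less[OF i] div_mod_less[OF j]
  have "((A \<otimes>\<^sub>K B) * (C \<otimes>\<^sub>K D)) $$ (i, j) = (\<Sum>l<n * n'.
      (A $$ (i div m', l div n') * C $$ (l div n', j div p')) *
      (B $$ (i mod m', l mod n') * D $$ (l mod n', j mod p')))"
    using assms i j
    by (simp add: times_mat_def scalar_prod_def kronecker_def atLeast0LessThan mult_ac)
  also have "\<dots> = (\<Sum>u<n. \<Sum>v<n'. (A $$ (i div m', u) * C $$ (u, j div p')) *
      (B $$ (i mod m', v) * D $$ (v, j mod p')))"
    by (rule sum_div_mod)
  also have "\<dots> = ((A * C) \<otimes>\<^sub>K (B * D)) $$ (i, j)"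
    using assms i j ij
    by (simp add: times_mat_def scalar_prod_def kronecker_def atLeast0LessThan sum_product)
  finally show "((A \<otimes>\<^sub>K B) * (C \<otimes>\<^sub>K D)) $$ (i, j) = ((A * C) \<otimes>\<^sub>K (B * D)) $$ (i, j)" .
qed (use assms in \<open>auto simp: kronecker_def\<close>)

text \<open>Two indices agree iff their quotients and their remainders by \<open>n\<close> agree, so
  the product of the two Kronecker deltas is again one.\<close>

lemma kronecker_scalar_mat:
  fixes a b :: "'a::comm_semiring_1"
  shows "(a \<cdot>\<^sub>m 1\<^sub>m m) \<otimes>\<^sub>K (b \<cdot>\<^sub>m 1\<^sub>m n) = (a * b) \<cdot>\<^sub>m 1\<^sub>m (m * n)"
proof (rule eq_matI)
  fix i j assume "i < dim_row ((a * b) \<cdot>\<^sub>m 1\<^sub>m (m * n))" "j < dim_col ((a * b) \<cdot>\<^sub>m 1\<^sub>m (m * n))"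
  then have i: "i < m * n" and j: "j < m * n" by auto
  have "i = j \<longleftrightarrow> i div n = j div n \<and> i mod n = j mod n"
    by (metis div_mult_mod_eq)
  then show "((a \<cdot>\<^sub>m 1\<^sub>m m) \<otimes>\<^sub>K (b \<cdot>\<^sub>m 1\<^sub>m n)) $$ (i, j) = ((a * b) \<cdot>\<^sub>m 1\<^sub>m (m * n)) $$ (i, j)"
    using i j div_mod_less[OF i] div_mod_less[OF j] by (auto simp: kronecker_def)
qed (auto simp: kronecker_def)

text \<open>With \<open>g = cnj\<close> this moves conjugation from the three-dimensional matrix to
  its one-dimensional factors.\<close>

lemma map_mat_kronecker:
  assumes "\<And>a b. g (a * b) = g a * g b"
  shows "map_mat g (A \<otimes>\<^sub>K B) = map_mat g A \<otimes>\<^sub>K map_mat g B"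
  by (rule eq_matI) (auto simp: kronecker_def div_mod_less assms)

lemma transpose_kronecker:
  "transpose_mat (A \<otimes>\<^sub>K B) = transpose_mat A \<otimes>\<^sub>K transpose_mat B"
  by (rule eq_matI) (auto simp: kronecker_def div_mod_less)

section \<open>One- and three-dimensional DFT matrices\<close>

lemma dft_mat_carrier: "dft_mat n \<in> carrier_mat n n"
  by (simp add: dft_mat_def)

lemma transpose_dft_mat: "transpose_mat (dft_mat n) = dft_mat n"
  by (rule eq_matI) (auto simp: dft_mat_def mult.commute)

text \<open>The sign of the exponent is absorbed by \<open>cnj\<close>, which leaves the enumeration
  of the roots of unity used in \<open>Complex.bij_betw_roots_unity\<close>.\<close>

lemma dft_root_power: "dft_root n ^ k = cnj (cis (2 * pi * real k / real n))"
proof -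
  have "dft_root n = cis (- (2 * pi / real n))"
    by (simp add: dft_root_def cis_conv_exp mult_ac)
  then show ?thesis
    by (simp add: Complex.DeMoivre cis_cnj mult_ac)
qed

text \<open>Orthogonality of characters: entry \<open>(j, k)\<close> is a geometric sum whose ratio
  \<open>q\<close> is an \<open>n\<close>-th root of unity. It is \<open>n\<close> if
  \<open>q = 1\<close>, that is \<open>j = k\<close>, and 0 otherwise.\<close>

lemma dft_mat_mult_cnj: "dft_mat n * map_mat cnj (dft_mat n) = of_nat n \<cdot>\<^sub>m 1\<^sub>m n"
proof (rule eq_matI)
  fix j k assume "j < dim_row (of_nat n \<cdot>\<^sub>m 1\<^sub>m n :: complex Matrix.mat)"
    "k < dim_col (of_nat n \<cdot>\<^sub>m 1\<^sub>m n :: complex Matrix.mat)"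
  then have j: "j < n" and k: "k < n" by auto
  \<comment> \<open>This is the root to the power \<open>j - k\<close>; conjugation serves as
    inverse, so that natural exponents suffice when \<open>j < k\<close>.\<close>
  define q where "q = dft_root n ^ j * cnj (dft_root n ^ k)"
  have cc: "cnj (dft_root n ^ k) * dft_root n ^ k = 1"
    by (simp only: dft_root_power complex_cnj_cnj) (simp add: cis_cnj cis_mult)
  have "q = 1 \<longleftrightarrow> j = k"
  proof
    assume "q = 1"
    then have "dft_root n ^ j = dft_root n ^ k"
      using cc unfolding q_def by (metis mult.assoc mult.left_neutral mult.right_neutral)
    then have "cis (2 * pi * real j / real n) = cis (2 * pi * real k / real n)"
      by (simp only: dft_root_power complex_cnj_cancel_iff)
    \<comment> \<open>Distinct exponents below \<open>n\<close> enumerate distinct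
      \<open>n\<close>-th roots of unity.\<close>
    then show "j = k"
      using bij_betw_imp_inj_on[OF Complex.bij_betw_roots_unity[of n]] j k by (auto dest: inj_onD)
  next
    assume "j = k" then show "q = 1" using cc by (simp add: q_def mult.commute)
  qed
  moreover have "q ^ n = 1"
  proof -
    have "dft_root n ^ n = 1" using j by (simp add: dft_root_power)
    then show ?thesis unfolding q_def
      by (simp add: power_mult_distrib flip: power_mult complex_cnj_power)
        (simp add: mult.commute[of _ n] power_mult)
  qed
  moreover have "(dft_mat n * map_mat cnj (dft_mat n)) $$ (j, k) = (\<Sum>l<n. q ^ l)"
    using j k by (simp add: times_mat_def scalar_prod_def dft_mat_def atLeast0LessThan q_def
        power_mult_distrib power_mult[symmetric] mult.commute)
  ultimately show "(dft_mat n * map_mat cnj (dft_mat n)) $$ (j, k) = (of_nat n \<cdot>\<^sub>m 1\<^sub>m n) $$ (j, k)"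
    using j k by (auto simp: geometric_sum)
qed (auto simp: dft_mat_def)

lemma dft3_mat_carrier: "dft3_mat f h w \<in> carrier_mat (f * h * w) (f * h * w)"
  unfolding dft3_mat_def by (intro kronecker_carrier dft_mat_carrier)

lemma transpose_dft3_mat: "transpose_mat (dft3_mat f h w) = dft3_mat f h w"
  by (simp add: dft3_mat_def transpose_kronecker transpose_dft_mat)

text \<open>The mixed product property, applied to the outer and to the inner Kronecker product,
  reduces the claim to three one-dimensional products; their scalars multiply to
  \<open>f * h * w\<close>.\<close>

lemma dft3_mat_mult_cnj:
  "dft3_mat f h w * map_mat cnj (dft3_mat f h w) = of_nat (f * h * w) \<cdot>\<^sub>m 1\<^sub>m (f * h * w)"
proof -
  have c: "map_mat cnj (dft_mat n) \<in> carrier_mat n n" for n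
    using dft_mat_carrier by simp
  show ?thesis
    unfolding dft3_mat_def
    by (simp add: map_mat_kronecker dft_mat_mult_cnj kronecker_scalar_mat
        kronecker_mult[OF kronecker_carrier[OF dft_mat_carrier dft_mat_carrier]
          kronecker_carrier[OF c c] dft_mat_carrier c]
        kronecker_mult[OF dft_mat_carrier c dft_mat_carrier c])
qed

section \<open>Matrix inverses, and real and imaginary parts of products\<close>

lemma mat_inv_eqI:
  fixes A B :: "'a::field Matrix.mat"
  assumes A: "A \<in> carrier_mat n n" and B: "B \<in> carrier_mat n n" and AB: "A * B = 1\<^sub>m n"
  shows "mat_inv A = B"
proof -
  \<comment> \<open>For square matrices over a field a right inverse is also a left inverse. Hence
    \<open>A\<close> is a unit of the matrix ring, \<open>mat_inverse\<close> does not return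
    \<open>None\<close>, and its result is \<open>B\<close> by uniqueness of inverses.\<close>
  have BA: "B * A = 1\<^sub>m n"
    using mat_mult_left_right_inverse[OF A B AB] .
  then have "A \<in> Units (ring_mat TYPE('a) n ())"
    using A B AB by (auto simp: Units_def ring_mat_simps)
  then obtain C where C: "mat_inverse A = Some C"
    using mat_inverse(1)[OF A, of "()"] by (cases "mat_inverse A") auto
  from mat_inverse(2)[OF A this] have "A * C = 1\<^sub>m n" "C \<in> carrier_mat n n" by auto
  moreover have "C = (B * A) * C" using \<open>C \<in> carrier_mat n n\<close> by (simp add: BA)
  moreover have "(B * A) * C = B * (A * C)"
    using A B \<open>C \<in> carrier_mat n n\<close> by (intro assoc_mult_mat)
  ultimately have "C = B" using B by simp
  then show ?thesis by (simp add: mat_inv_def C)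
qed

lemma map_mat_Re_mult:
  assumes "dim_col X = dim_row Y"
  shows "map_mat Re (X * Y) = map_mat Re X * map_mat Re Y - map_mat Im X * map_mat Im Y"
  using assms by (intro eq_matI) (auto simp: times_mat_def scalar_prod_def sum_subtractf)

lemma map_mat_Re_mult_cmat:
  assumes "dim_col X = dim_row Y"
  shows "map_mat Re (X * cmat Y) = map_mat Re X * Y"
  using assms by (intro eq_matI) (auto simp: times_mat_def scalar_prod_def)

lemma map_mat_Im_mult_cmat:
  assumes "dim_col X = dim_row Y"
  shows "map_mat Im (X * cmat Y) = map_mat Im X * Y"
  using assms by (intro eq_matI) (auto simp: times_mat_def scalar_prod_def)

lemma map_vec_Re_mult_cvec:
  assumes "dim_col X = dim_vec v"
  shows "map_vec Re (X *\<^sub>v cvec v) = map_mat Re X *\<^sub>v v"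
  using assms by (intro eq_vecI) (auto simp: mult_mat_vec_def scalar_prod_def)

lemma transpose_diagonal_mat:
  assumes "D \<in> carrier_mat n n" "diagonal_mat D"
  shows "transpose_mat D = D"
  using assms by (intro eq_matI) (auto simp: diagonal_mat_def, metis)

section \<open>The real filter matrices \<open>P\<close> and \<open>I - P\<close>\<close>

context
  fixes N :: nat and F :: "complex Matrix.mat" and A B L P :: "real Matrix.mat"
  assumes N: "N > 0" and F: "F \<in> carrier_mat N N"
    and F_cnj: "F * map_mat cnj F = of_nat N \<cdot>\<^sub>m 1\<^sub>m N"
    and A: "A = map_mat Re F" and B: "B = map_mat Im F"
    and L: "L \<in> carrier_mat N N"
    and P: "P = (1 / real N) \<cdot>\<^sub>m (A * L * A + B * L * B)"
begin

text \<open>Division of \<open>F_cnj\<close> by \<open>N > 0\<close>. For the symmetric DFT matrix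
  the plain conjugate is the conjugate transpose, so this is the usual inverse.\<close>

lemma mat_inv_eq_cnj: "mat_inv F = (1 / of_nat N) \<cdot>\<^sub>m map_mat cnj F"
proof (rule mat_inv_eqI[OF F])
  have "F * ((1 / of_nat N) \<cdot>\<^sub>m map_mat cnj F) = (1 / of_nat N) \<cdot>\<^sub>m (F * map_mat cnj F)"
    using F by (intro mult_smult_distrib) auto
  also have "\<dots> = 1\<^sub>m N"
    unfolding F_cnj using N by (intro eq_matI) auto
  finally show "F * ((1 / of_nat N) \<cdot>\<^sub>m map_mat cnj F) = 1\<^sub>m N" .
qed (use F in auto)

text \<open>The real part of \<open>(A - iB) L (A + iB)\<close> is \<open>A L A + B L B\<close> for
  real \<open>L\<close>: the mixed terms are purely imaginary, and the minus sign of the conjugate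
  cancels that of \<open>i * i = -1\<close>.\<close>

lemma Re_filter: "map_mat Re (mat_inv F * cmat L * F) = P"
proof -
  have Re: "map_mat Re (mat_inv F) = (1 / real N) \<cdot>\<^sub>m A"
    and Im: "map_mat Im (mat_inv F) = - ((1 / real N) \<cdot>\<^sub>m B)"
    using F by (auto simp: mat_inv_eq_cnj A B intro!: eq_matI)
  have AB: "A \<in> carrier_mat N N" "B \<in> carrier_mat N N" using F by (auto simp: A B)
  have G: "mat_inv F \<in> carrier_mat N N" using F by (auto simp: mat_inv_eq_cnj)
  have "map_mat Re (mat_inv F * cmat L * F) =
      map_mat Re (mat_inv F * cmat L) * A - map_mat Im (mat_inv F * cmat L) * B"
    unfolding A B using F L by (intro map_mat_Re_mult) auto
  also have "\<dots> = (1 / real N) \<cdot>\<^sub>m A * L * A - - ((1 / real N) \<cdot>\<^sub>m B) * L * B"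
    using G L by (subst map_mat_Re_mult_cmat map_mat_Im_mult_cmat; simp add: Re Im)+
  also have "\<dots> = P"
    unfolding P using AB L
    by (intro eq_matI) (auto simp: times_mat_def scalar_prod_def sum_distrib_left
        sum_distrib_right sum_negf mult_ac distrib_left)
  finally show ?thesis .
qed

text \<open>By distributivity the complementary filter is \<open>mat_inv F * F\<close> minus the
  filter itself, and \<open>mat_inv F * F\<close> is the identity; the real part then follows from
  \<open>Re_filter\<close>.\<close>

lemma Re_filter_compl: "map_mat Re (mat_inv F * cmat (1\<^sub>m N - L) * F) = 1\<^sub>m N - P"
proof -
  have G: "mat_inv F \<in> carrier_mat N N" using F by (auto simp: mat_inv_eq_cnj)
  have "mat_inv F * F = 1\<^sub>m N"
  proof (rule mat_mult_left_right_inverse[OF F G])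
    show "F * mat_inv F = 1\<^sub>m N"
      unfolding mat_inv_eq_cnj using F N
      by (subst mult_smult_distrib[OF F]) (auto simp: F_cnj intro!: eq_matI)
  qed
  moreover have "cmat (1\<^sub>m N - L) = 1\<^sub>m N - cmat L"
    using L by (intro eq_matI) auto
  ultimately have "mat_inv F * cmat (1\<^sub>m N - L) * F = 1\<^sub>m N - mat_inv F * cmat L * F"
    using F G L by (simp add: mult_minus_distrib_mat[of _ N N _ N] minus_mult_distrib_mat[of _ N N])
  moreover have "map_mat Re (1\<^sub>m N - X) = 1\<^sub>m N - map_mat Re X" if "X \<in> carrier_mat N N" for X
    using that by (intro eq_matI) auto
  ultimately show ?thesis
    using F G L Re_filter by simp
qed

text \<open>Transposition reverses products, so \<open>X * L * X\<close> is symmetric when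
  \<open>X\<close> and \<open>L\<close> are; \<open>A\<close> and \<open>B\<close> inherit symmetry
  from \<open>F\<close> entrywise.\<close>

lemma transpose_filter:
  assumes "transpose_mat F = F" "transpose_mat L = L"
  shows "transpose_mat P = P"
proof -
  have T: "transpose_mat A = A" "transpose_mat B = B"
    unfolding A B by (metis assms(1) map_mat_transpose)+
  have AB: "A \<in> carrier_mat N N" "B \<in> carrier_mat N N" using F by (auto simp: A B)
  have "transpose_mat (X * L * X) = X * L * X" if "X \<in> carrier_mat N N" "transpose_mat X = X" for X
    using that assms L by (simp add: transpose_mult[of _ N N _ N])
  moreover have "transpose_mat (a \<cdot>\<^sub>m X) = a \<cdot>\<^sub>m transpose_mat X" for a :: real and X
    by (intro eq_matI) auto
  ultimately show ?thesis
    unfolding P using AB L T by (simp add: transpose_add[of _ N N])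
qed

end

section \<open>Gaussian vectors\<close>

lemma gaussian_real_square_integrable:
  assumes "gaussian_real \<nu>"
  shows "integrable \<nu> (\<lambda>x. x\<^sup>2)"
  using assms unfolding gaussian_real_def
proof (elim disjE exE conjE)
  fix m s :: real assume s: "s > 0" and \<nu>: "\<nu> = density lborel (\<lambda>t. ennreal (normal_density m s t))"
  \<comment> \<open>The second moment about 0 is reduced to known moments by writing the square of
    \<open>x\<close> as \<open>(x - m) ^ 2 + 2 * m * x - m ^ 2\<close>.\<close>
  have "integrable lborel (\<lambda>x. normal_density m s x * (x - m) ^ 2 +
      2 * m * (normal_density m s x * x) - m\<^sup>2 * normal_density m s x)"
    using s by (intro Bochner_Integration.integrable_add Bochner_Integration.integrable_diff
        integrable_mult_right integrable_normal_moment integrable_normal_moment_nz_1) auto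
  then have "integrable lborel (\<lambda>x. normal_density m s x * x\<^sup>2)"
    by (rule back_subst[of "integrable lborel"]) (auto simp: power2_eq_square algebra_simps)
  then show ?thesis
    by (simp add: \<nu> integrable_density normal_density_nonneg)
next
  fix m :: real assume \<nu>: "\<nu> = return borel m"
  interpret prob_space \<nu> unfolding \<nu> by (rule prob_space_return) simp
  have "AE x in \<nu>. x\<^sup>2 = m\<^sup>2"
    unfolding \<nu> by (subst AE_return) auto
  moreover have "(\<lambda>x. x\<^sup>2) \<in> borel_measurable \<nu>"
    unfolding \<nu> by simp
  ultimately show ?thesis
    by (subst integrable_cong_AE[of _ _ "\<lambda>_. m\<^sup>2"]) auto
qed

text \<open>Translates between equality of laws, as in \<open>gaussian_real\<close>, and the
  predicate \<open>distributed\<close> of the library facts on normal densities. The laws over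
  \<open>lborel\<close> and \<open>borel\<close> coincide because the two have the same measurable
  sets.\<close>

lemma (in prob_space) distributed_normal_density_iff:
  assumes "X \<in> borel_measurable M"
  shows "distributed M lborel X (normal_density m s) \<longleftrightarrow>
    distr M borel X = density lborel (normal_density m s)"
proof -
  have "distr M lborel X = distr M borel X" by (rule distr_cong) auto
  then show ?thesis using assms by (auto simp: distributed_def)
qed

text \<open>Turns the degenerate case into an almost sure equality, which can be inserted into
  sums.\<close>

lemma (in prob_space) distr_eq_return_iff:
  assumes "X \<in> borel_measurable M"
  shows "distr M borel X = return borel (m::real) \<longleftrightarrow> (AE s in M. X s = m)"
proof
  assume *: "distr M borel X = return borel m"
  have "AE x in distr M borel X. x = m"
    unfolding * by (subst AE_return) auto
  then show "AE s in M. X s = m"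
    using assms by (subst (asm) AE_distr_iff) auto
next
  assume "AE s in M. X s = m"
  then have "distr M borel X = distr M borel (\<lambda>_. m)"
    using assms by (intro distr_cong_AE) auto
  then show "distr M borel X = return borel m"
    by (simp add: distr_const)
qed

text \<open>An almost surely constant summand only translates the law, and translation preserves
  both normal densities and point masses.\<close>

lemma (in prob_space) gaussian_real_add_const:
  assumes X: "X \<in> borel_measurable M" and Y: "Y \<in> borel_measurable M"
    and gY: "gaussian_real (distr M borel Y)" and c: "AE s in M. X s = c"
  shows "gaussian_real (distr M borel (\<lambda>s. X s + Y s))"
proof -
  \<comment> \<open>The factor \<open>1\<close> gives the affine form that
    \<open>normal_density_affine\<close> expects.\<close>
  have eq: "distr M borel (\<lambda>s. X s + Y s) = distr M borel (\<lambda>s. c + 1 * Y s)"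
    using X Y c by (intro distr_cong_AE) auto
  from gY show ?thesis unfolding gaussian_real_def
  proof (elim disjE exE conjE)
    fix m s assume s: "0 < s" and "distr M borel Y = density lborel (normal_density m s)"
    then have "distributed M lborel Y (normal_density m s)"
      using Y by (simp add: distributed_normal_density_iff)
    from normal_density_affine[OF this s, of 1 c, OF one_neq_zero]
    have "distr M borel (\<lambda>s. c + 1 * Y s) = density lborel (normal_density (c + 1 * m) (\<bar>1\<bar> * s))"
      using Y by (subst (asm) distributed_normal_density_iff) auto
    then show "(\<exists>m s. s > 0 \<and> distr M borel (\<lambda>s. X s + Y s) = density lborel (normal_density m s)) \<or>
        (\<exists>m. distr M borel (\<lambda>s. X s + Y s) = return borel m)"
      unfolding eq using s by (metis abs_one mult_1)
  next
    fix m assume "distr M borel Y = return borel m"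
    then have "AE s in M. Y s = m" using Y by (simp add: distr_eq_return_iff)
    then have "AE s in M. c + 1 * Y s = c + m" by eventually_elim simp
    then have "distr M borel (\<lambda>s. c + 1 * Y s) = return borel (c + m)"
      using Y by (subst distr_eq_return_iff) auto
    then show "(\<exists>m s. s > 0 \<and> distr M borel (\<lambda>s. X s + Y s) = density lborel (normal_density m s)) \<or>
        (\<exists>m. distr M borel (\<lambda>s. X s + Y s) = return borel m)"
      unfolding eq by blast
  qed
qed

text \<open>If one summand is degenerate, the sum is a translate of the other. Otherwise both have
  normal densities, and independence gives a normal density whose variance is the sum of the
  two.\<close>

lemma (in prob_space) gaussian_real_add:
  assumes ind: "indep_var borel X borel Y"
    and gX: "gaussian_real (distr M borel X)" and gY: "gaussian_real (distr M borel Y)"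
  shows "gaussian_real (distr M borel (\<lambda>s. X s + Y s))"
proof -
  have X: "X \<in> borel_measurable M" and Y: "Y \<in> borel_measurable M"
    using ind by (auto dest: indep_var_rv1 indep_var_rv2)
  show ?thesis
  proof (cases "(\<exists>m. distr M borel X = return borel m) \<or> (\<exists>m. distr M borel Y = return borel m)")
    case True
    then show ?thesis
      using gaussian_real_add_const[OF X Y gY] gaussian_real_add_const[OF Y X gX] X Y
      by (auto simp: distr_eq_return_iff add.commute)
  next
    case False
    then obtain a b s t where st: "s > 0" "t > 0"
      and d: "distributed M lborel X (normal_density a s)" "distributed M lborel Y (normal_density b t)"
      using gX gY X Y by (auto simp: gaussian_real_def distributed_normal_density_iff)
    from add_indep_normal[OF ind st d]
    have "distr M borel (\<lambda>x. X x + Y x) = density lborel (normal_density (a + b) (sqrt (s\<^sup>2 + t\<^sup>2)))"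
      using X Y by (subst (asm) distributed_normal_density_iff) auto
    moreover have "sqrt (s\<^sup>2 + t\<^sup>2) > 0"
      using st by (simp add: add_pos_pos)
    ultimately show ?thesis unfolding gaussian_real_def by blast
  qed
qed

section \<open>Measurability of vector-valued maps, and Gaussian vectors through
  expectations\<close>

lemma space_vec_borel: "space (vec_borel n) = carrier_vec n"
  by (simp add: vec_borel_def)

lemma measurable_vec_borel_index:
  assumes "i < n"
  shows "(\<lambda>v. v $ i) \<in> borel_measurable (vec_borel n)"
proof -
  have "(\<lambda>v. \<lambda>i\<in>{..<n}. v $ i) \<in> measurable (vec_borel n) (\<Pi>\<^sub>M i\<in>{..<n}. borel)"
    unfolding vec_borel_def by (rule measurable_vimage_algebra1) (auto simp: space_PiM)
  then have "(\<lambda>v. (\<lambda>i\<in>{..<n}. v $ i) i) \<in> borel_measurable (vec_borel n)"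
    by (rule measurable_compose[OF _ measurable_component_singleton]) (use assms in simp)
  then show ?thesis using assms by simp
qed

text \<open>A map into an initial \<sigma>-algebra is measurable iff its composite with the
  generating map is; here that map goes to the finite product, where measurability is tested on
  coordinates.\<close>

lemma measurable_vec_borel_iff:
  "X \<in> measurable M (vec_borel n) \<longleftrightarrow>
    X \<in> space M \<rightarrow> carrier_vec n \<and> (\<forall>i<n. (\<lambda>s. X s $ i) \<in> borel_measurable M)"
proof safe
  fix s assume "X \<in> measurable M (vec_borel n)" "s \<in> space M"
  then show "X s \<in> carrier_vec n"
    by (metis measurable_space space_vec_borel)
next
  fix i assume "X \<in> measurable M (vec_borel n)" "i < n"
  then show "(\<lambda>s. X s $ i) \<in> borel_measurable M"
    by (rule measurable_compose[OF _ measurable_vec_borel_index])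
next
  assume "X \<in> space M \<rightarrow> carrier_vec n" "\<forall>i<n. (\<lambda>s. X s $ i) \<in> borel_measurable M"
  then show "X \<in> measurable M (vec_borel n)"
    unfolding vec_borel_def by (intro measurable_vimage_algebra2 measurable_restrict) auto
qed

lemma measurable_scalar_prod:
  assumes "t \<in> carrier_vec n"
  shows "(\<lambda>v. t \<bullet> v) \<in> borel_measurable (vec_borel n)"
proof -
  have "(\<lambda>v. \<Sum>i<n. t $ i * v $ i) \<in> borel_measurable (vec_borel n)"
    by (intro borel_measurable_sum borel_measurable_times measurable_vec_borel_index) auto
  then show ?thesis
    by (subst measurable_cong) (auto simp: space_vec_borel scalar_prod_def atLeast0LessThan)
qed

lemma measurable_mult_mat_vec:
  assumes A: "A \<in> carrier_mat m n"
  shows "(\<lambda>v. A *\<^sub>v v) \<in> measurable (vec_borel n) (vec_borel m)"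
proof -
  have "(\<lambda>v. (A *\<^sub>v v) $ i) \<in> borel_measurable (vec_borel n)" if "i < m" for i
    using A that measurable_scalar_prod[of "row A i" n] by (subst measurable_cong) auto
  then show ?thesis
    using A by (auto simp: measurable_vec_borel_iff space_vec_borel)
qed

text \<open>Change of variables: the conditions on the law of \<open>X\<close> become conditions on
  functionals and expectations over \<open>M\<close>. In the last clause \<open>\<mu>\<close> may
  replace the mean because the second clause identifies them.\<close>

lemma (in prob_space) normal_distributed_iff:
  assumes X: "X \<in> measurable M (vec_borel n)"
  shows "normal_distributed n M X \<mu> \<Sigma> \<longleftrightarrow>
    (\<forall>t\<in>carrier_vec n. gaussian_real (distr M borel (\<lambda>s. t \<bullet> X s))) \<and>
    \<mu> = Matrix.vec n (\<lambda>i. expectation (\<lambda>s. X s $ i)) \<and>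
    \<Sigma> = Matrix.mat n n (\<lambda>(i, j). expectation (\<lambda>s. (X s $ i - \<mu> $ i) * (X s $ j - \<mu> $ j)))"
proof -
  let ?D = "distr M (vec_borel n) X"
  have "prob_space ?D" by (rule prob_space_distr) fact
  moreover have "distr ?D borel (\<lambda>v. t \<bullet> v) = distr M borel (\<lambda>s. t \<bullet> X s)" if "t \<in> carrier_vec n" for t
    using that X by (subst distr_distr) (auto simp: measurable_scalar_prod comp_def)
  ultimately have g: "gaussian_vec n ?D \<longleftrightarrow>
      (\<forall>t\<in>carrier_vec n. gaussian_real (distr M borel (\<lambda>s. t \<bullet> X s)))"
    by (auto simp: gaussian_vec_def)
  have m: "mean_vec n ?D = Matrix.vec n (\<lambda>i. expectation (\<lambda>s. X s $ i))"
    unfolding mean_vec_def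
    by (rule eq_vecI) (auto intro!: integral_distr X measurable_vec_borel_index)
  have cov: "cov_mat n ?D = Matrix.mat n n (\<lambda>(i, j). expectation
      (\<lambda>s. (X s $ i - mean_vec n ?D $ i) * (X s $ j - mean_vec n ?D $ j)))"
    unfolding cov_mat_def
    by (rule eq_matI) (auto intro!: integral_distr X measurable_vec_borel_index
        borel_measurable_times borel_measurable_diff)
  then show ?thesis
    unfolding normal_distributed_def g m[symmetric] cov using X by auto
qed

text \<open>The product is dominated by the sum of the squares.\<close>

lemma integrable_mult_of_squares:
  fixes X Y :: "'a \<Rightarrow> real"
  assumes [measurable]: "X \<in> borel_measurable M" "Y \<in> borel_measurable M"
    and "integrable M (\<lambda>s. (X s)\<^sup>2)" "integrable M (\<lambda>s. (Y s)\<^sup>2)"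
  shows "integrable M (\<lambda>s. X s * Y s)"
proof (rule Bochner_Integration.integrable_bound)
  show "integrable M (\<lambda>s. (X s)\<^sup>2 + (Y s)\<^sup>2)" using assms by simp
  have "\<bar>a * b\<bar> \<le> a\<^sup>2 + b\<^sup>2" for a b :: real
  proof -
    have "2 * \<bar>a * b\<bar> \<le> a\<^sup>2 + b\<^sup>2"
      using sum_squares_bound[of "\<bar>a\<bar>" "\<bar>b\<bar>"] by (simp add: abs_mult)
    then show ?thesis using abs_ge_zero[of "a * b"] by linarith
  qed
  then show "AE s in M. norm (X s * Y s) \<le> norm ((X s)\<^sup>2 + (Y s)\<^sup>2)" by simp
qed simp

section \<open>Moments, linear images and independent sums of Gaussian vectors\<close>

context prob_space
begin

context
  fixes n :: nat and X :: "'a \<Rightarrow> real Matrix.vec" and \<mu> \<Sigma>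
  assumes X: "normal_distributed n M X \<mu> \<Sigma>"
begin

lemma normal_distributed_measurable: "X \<in> measurable M (vec_borel n)"
  using X by (simp add: normal_distributed_def)

lemma normal_distributed_carrier:
  "\<mu> \<in> carrier_vec n" "\<Sigma> \<in> carrier_mat n n" "s \<in> space M \<Longrightarrow> X s \<in> carrier_vec n"
  using X normal_distributed_measurable
  by (auto simp: normal_distributed_iff measurable_vec_borel_iff)

lemma normal_distributed_index_measurable:
  "i < n \<Longrightarrow> (\<lambda>s. X s $ i) \<in> borel_measurable M"
  using normal_distributed_measurable by (simp add: measurable_vec_borel_iff)

lemma normal_distributed_scalar_prod:
  "t \<in> carrier_vec n \<Longrightarrow> gaussian_real (distr M borel (\<lambda>s. t \<bullet> X s))"
  using X normal_distributed_measurable by (simp add: normal_distributed_iff)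

lemma normal_distributed_mean: "i < n \<Longrightarrow> expectation (\<lambda>s. X s $ i) = \<mu> $ i"
  using X normal_distributed_measurable by (simp add: normal_distributed_iff)

lemma normal_distributed_cov:
  "i < n \<Longrightarrow> j < n \<Longrightarrow> expectation (\<lambda>s. (X s $ i - \<mu> $ i) * (X s $ j - \<mu> $ j)) = \<Sigma> $$ (i, j)"
  using X normal_distributed_measurable normal_distributed_iff[of X n \<mu> \<Sigma>] by auto

text \<open>A coordinate is the functional given by a unit vector, hence has a one-dimensional
  Gaussian law with finite second moment.\<close>

lemma normal_distributed_index_square_integrable:
  assumes i: "i < n"
  shows "integrable M (\<lambda>s. (X s $ i)\<^sup>2)"
proof -
  have "distr M borel (\<lambda>s. unit_vec n i \<bullet> X s) = distr M borel (\<lambda>s. X s $ i)"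
    using i by (intro distr_cong) (auto simp: normal_distributed_carrier scalar_prod_left_unit)
  then have "gaussian_real (distr M borel (\<lambda>s. X s $ i))"
    using normal_distributed_scalar_prod[of "unit_vec n i"] by simp
  from gaussian_real_square_integrable[OF this] show ?thesis
    using i by (subst (asm) integrable_distr_eq) (auto simp: normal_distributed_index_measurable)
qed

text \<open>The coordinate is multiplied by the constant 1, which is square integrable over a
  probability space.\<close>

lemma normal_distributed_index_integrable:
  assumes i: "i < n"
  shows "integrable M (\<lambda>s. X s $ i)"
  using integrable_mult_of_squares[where X = "\<lambda>s. X s $ i" and Y = "\<lambda>_. 1" and M = M] i
  by (simp add: normal_distributed_index_measurable normal_distributed_index_square_integrable)

lemma normal_distributed_centered_integrable:
  assumes "i < n" "j < n"
  shows "integrable M (\<lambda>s. (X s $ i - \<mu> $ i) * (X s $ j - \<mu> $ j))"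
proof -
  have "integrable M (\<lambda>s. X s $ i * X s $ j)"
    using assms by (intro integrable_mult_of_squares normal_distributed_index_measurable
        normal_distributed_index_square_integrable)
  then have "integrable M (\<lambda>s. X s $ i * X s $ j - \<mu> $ i * X s $ j - \<mu> $ j * X s $ i + \<mu> $ i * \<mu> $ j)"
    using assms by (intro Bochner_Integration.integrable_add Bochner_Integration.integrable_diff
        integrable_mult_right normal_distributed_index_integrable) auto
  then show ?thesis
    by (rule back_subst[of "integrable M"]) (auto simp: algebra_simps)
qed

text \<open>Functionals of \<open>A *\<^sub>v X s\<close> are functionals of \<open>X s\<close>, by
  moving \<open>A\<close> to the other side as its transpose. The mean follows from linearity and
  the covariance from bilinearity of the expectation.\<close>

lemma normal_distributed_mult_mat_vec:
  assumes A: "A \<in> carrier_mat m n"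
  shows "normal_distributed m M (\<lambda>s. A *\<^sub>v X s) (A *\<^sub>v \<mu>) (A * \<Sigma> * transpose_mat A)"
proof -
  note [simp] = normal_distributed_carrier
  have meas: "(\<lambda>s. A *\<^sub>v X s) \<in> measurable M (vec_borel m)"
    by (rule measurable_compose[OF normal_distributed_measurable measurable_mult_mat_vec[OF A]])
  have row: "(A *\<^sub>v v) $ i = (\<Sum>k<n. A $$ (i, k) * v $ k)" if "i < m" "v \<in> carrier_vec n" for i v
    using A that by (simp add: mult_mat_vec_def scalar_prod_def atLeast0LessThan)
  have "gaussian_real (distr M borel (\<lambda>s. t \<bullet> (A *\<^sub>v X s)))" if t: "t \<in> carrier_vec m" for t
  proof -
    have "distr M borel (\<lambda>s. t \<bullet> (A *\<^sub>v X s)) = distr M borel (\<lambda>s. (transpose_mat A *\<^sub>v t) \<bullet> X s)"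
      using A t by (intro distr_cong) (auto simp: transpose_vec_mult_scalar)
    then show ?thesis
      using A t by (simp add: normal_distributed_scalar_prod)
  qed
  moreover have "A *\<^sub>v \<mu> = Matrix.vec m (\<lambda>i. expectation (\<lambda>s. (A *\<^sub>v X s) $ i))"
  proof (rule eq_vecI)
    fix i assume "i < dim_vec (Matrix.vec m (\<lambda>i. expectation (\<lambda>s. (A *\<^sub>v X s) $ i)))"
    then have i: "i < m" by simp
    have "expectation (\<lambda>s. (A *\<^sub>v X s) $ i) = expectation (\<lambda>s. \<Sum>k<n. A $$ (i, k) * X s $ k)"
      using i by (intro Bochner_Integration.integral_cong) (auto simp: row)
    also have "\<dots> = (\<Sum>k<n. A $$ (i, k) * \<mu> $ k)"
      by (subst Bochner_Integration.integral_sum)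
        (auto simp: normal_distributed_index_integrable normal_distributed_mean)
    finally show "(A *\<^sub>v \<mu>) $ i = Matrix.vec m (\<lambda>i. expectation (\<lambda>s. (A *\<^sub>v X s) $ i)) $ i"
      using i by (simp add: row)
  qed (use A in simp)
  moreover have "A * \<Sigma> * transpose_mat A = Matrix.mat m m (\<lambda>(i, j). expectation
      (\<lambda>s. ((A *\<^sub>v X s) $ i - (A *\<^sub>v \<mu>) $ i) * ((A *\<^sub>v X s) $ j - (A *\<^sub>v \<mu>) $ j)))" (is "_ = ?C")
  proof (rule eq_matI)
    fix i j assume "i < dim_row ?C" "j < dim_col ?C"
    then have i: "i < m" and j: "j < m" by auto
    have "expectation (\<lambda>s. ((A *\<^sub>v X s) $ i - (A *\<^sub>v \<mu>) $ i) * ((A *\<^sub>v X s) $ j - (A *\<^sub>v \<mu>) $ j)) =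
        expectation (\<lambda>s. \<Sum>k<n. \<Sum>l<n. A $$ (i, k) * A $$ (j, l) *
          ((X s $ k - \<mu> $ k) * (X s $ l - \<mu> $ l)))"
    proof (rule Bochner_Integration.integral_cong[OF refl])
      fix s assume s: "s \<in> space M"
      have *: "(A *\<^sub>v X s) $ i - (A *\<^sub>v \<mu>) $ i = (\<Sum>k<n. A $$ (i, k) * (X s $ k - \<mu> $ k))"
        if "i < m" for i
        using that s by (simp add: row sum_subtractf right_diff_distrib)
      show "((A *\<^sub>v X s) $ i - (A *\<^sub>v \<mu>) $ i) * ((A *\<^sub>v X s) $ j - (A *\<^sub>v \<mu>) $ j) =
          (\<Sum>k<n. \<Sum>l<n. A $$ (i, k) * A $$ (j, l) * ((X s $ k - \<mu> $ k) * (X s $ l - \<mu> $ l)))"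
        by (simp only: *[OF i] *[OF j] sum_product mult_ac)
    qed
    also have "\<dots> = (\<Sum>k<n. \<Sum>l<n. A $$ (i, k) * A $$ (j, l) * \<Sigma> $$ (k, l))"
    proof -
      have int: "integrable M (\<lambda>s. c * ((X s $ k - \<mu> $ k) * (X s $ l - \<mu> $ l)))"
        if "k \<in> {..<n}" "l \<in> {..<n}" for c k l
        using that by (intro integrable_mult_right normal_distributed_centered_integrable) auto
      show ?thesis
        by (subst Bochner_Integration.integral_sum,
            intro Bochner_Integration.integrable_sum int, assumption+,
            intro sum.cong refl, subst Bochner_Integration.integral_sum, intro int, assumption+)
          (auto simp: normal_distributed_cov)
    qed
    \<comment> \<open>In the triple product, bracketed to the left, the column index of
      \<open>\<Sigma>\<close> is summed outermost, hence the exchange of the two sums.\<close>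
    also have "\<dots> = (A * \<Sigma> * transpose_mat A) $$ (i, j)"
      using A i j
      by (subst sum.swap) (simp add: times_mat_def scalar_prod_def atLeast0LessThan
          normal_distributed_carrier(2)[THEN carrier_matD(1)]
          normal_distributed_carrier(2)[THEN carrier_matD(2)] sum_distrib_left mult_ac)
    finally show "(A * \<Sigma> * transpose_mat A) $$ (i, j) = ?C $$ (i, j)"
      using i j by simp
  qed (use A in auto)
  ultimately show ?thesis
    using meas by (auto simp: normal_distributed_iff)
qed

end

text \<open>Each functional of the sum is a sum of two independent real Gaussians. Covariances add
  because the cross terms are products of independent centered variables and have expectation
  0.\<close>

lemma normal_distributed_add:
  assumes X: "normal_distributed n M X \<mu> \<Sigma>" and Y: "normal_distributed n M Y \<nu> T"
    and ind: "indep_var (vec_borel n) X (vec_borel n) Y"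
  shows "normal_distributed n M (\<lambda>s. X s + Y s) (\<mu> + \<nu>) (\<Sigma> + T)"
proof -
  note [simp] = normal_distributed_carrier[OF X] normal_distributed_carrier[OF Y]
  note [simp] = normal_distributed_carrier(1)[OF X, THEN carrier_vecD]
    normal_distributed_carrier(1)[OF Y, THEN carrier_vecD]
    normal_distributed_carrier(2)[OF X, THEN carrier_matD(1)]
    normal_distributed_carrier(2)[OF X, THEN carrier_matD(2)]
    normal_distributed_carrier(2)[OF Y, THEN carrier_matD(1)]
    normal_distributed_carrier(2)[OF Y, THEN carrier_matD(2)]
    normal_distributed_carrier(3)[OF X, THEN carrier_vecD]
    normal_distributed_carrier(3)[OF Y, THEN carrier_vecD]
  \<comment> \<open>Independence passes from the vectors to real functions of them, used below for
    the functionals \<open>t \<bullet> v\<close> and for the centered coordinates.\<close>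
  have ind': "indep_var borel (\<lambda>s. g (X s)) borel (\<lambda>s. g' (Y s))"
    if "g \<in> borel_measurable (vec_borel n)" "g' \<in> borel_measurable (vec_borel n)"
    for g g' :: "real Matrix.vec \<Rightarrow> real"
    using indep_var_compose[OF ind that] by (simp add: comp_def)
  have meas: "(\<lambda>s. X s + Y s) \<in> measurable M (vec_borel n)"
    unfolding measurable_vec_borel_iff
  proof safe
    fix i assume i: "i < n"
    have "(\<lambda>s. X s $ i + Y s $ i) \<in> borel_measurable M"
      using i by (intro borel_measurable_add normal_distributed_index_measurable[OF X]
          normal_distributed_index_measurable[OF Y])
    then show "(\<lambda>s. (X s + Y s) $ i) \<in> borel_measurable M"
      using i by (subst measurable_cong) auto
  qed auto
  have "gaussian_real (distr M borel (\<lambda>s. t \<bullet> (X s + Y s)))" if t: "t \<in> carrier_vec n" for t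
  proof -
    have "distr M borel (\<lambda>s. t \<bullet> (X s + Y s)) = distr M borel (\<lambda>s. t \<bullet> X s + t \<bullet> Y s)"
      using t by (intro distr_cong) (auto simp: scalar_prod_add_distrib[of _ n])
    moreover have "gaussian_real (distr M borel (\<lambda>s. t \<bullet> X s + t \<bullet> Y s))"
      using t by (intro gaussian_real_add ind' measurable_scalar_prod
          normal_distributed_scalar_prod[OF X] normal_distributed_scalar_prod[OF Y])
    ultimately show ?thesis by simp
  qed
  moreover have "\<mu> + \<nu> = Matrix.vec n (\<lambda>i. expectation (\<lambda>s. (X s + Y s) $ i))"
  proof (rule eq_vecI)
    fix i assume "i < dim_vec (Matrix.vec n (\<lambda>i. expectation (\<lambda>s. (X s + Y s) $ i)))"
    then have i: "i < n" by simp
    have "expectation (\<lambda>s. (X s + Y s) $ i) = expectation (\<lambda>s. X s $ i + Y s $ i)"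
      using i by (intro Bochner_Integration.integral_cong) auto
    also have "\<dots> = \<mu> $ i + \<nu> $ i"
      using i by (simp add: normal_distributed_index_integrable[OF X]
          normal_distributed_index_integrable[OF Y] normal_distributed_mean[OF X]
          normal_distributed_mean[OF Y])
    finally show "(\<mu> + \<nu>) $ i = Matrix.vec n (\<lambda>i. expectation (\<lambda>s. (X s + Y s) $ i)) $ i"
      using i by simp
  qed simp
  moreover have "\<Sigma> + T = Matrix.mat n n (\<lambda>(i, j). expectation
      (\<lambda>s. ((X s + Y s) $ i - (\<mu> + \<nu>) $ i) * ((X s + Y s) $ j - (\<mu> + \<nu>) $ j)))" (is "_ = ?C")
  proof (rule eq_matI)
    fix i j assume "i < dim_row ?C" "j < dim_col ?C"
    then have i: "i < n" and j: "j < n" by auto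
    let ?X = "\<lambda>k s. X s $ k - \<mu> $ k" and ?Y = "\<lambda>k s. Y s $ k - \<nu> $ k"
    have XY: "integrable M (\<lambda>s. ?X k s * ?Y l s)" "expectation (\<lambda>s. ?X k s * ?Y l s) = 0"
      if k: "k < n" and l: "l < n" for k l
    proof -
      have ind: "indep_var borel (?X k) borel (?Y l)"
        using k l by (intro ind' borel_measurable_diff measurable_vec_borel_index) auto
      have int: "integrable M (?X k)" "integrable M (?Y l)"
        using k l by (auto simp: normal_distributed_index_integrable[OF X]
            normal_distributed_index_integrable[OF Y])
      show "integrable M (\<lambda>s. ?X k s * ?Y l s)"
        by (rule indep_var_integrable[OF ind int])
      have "expectation (?X k) = 0"
        using k by (simp add: normal_distributed_index_integrable[OF X]
            normal_distributed_mean[OF X] prob_space)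
      then show "expectation (\<lambda>s. ?X k s * ?Y l s) = 0"
        by (simp add: indep_var_lebesgue_integral[OF ind int])
    qed
    \<comment> \<open>Both cross terms are written with the factor from \<open>X\<close> first, so
      that \<open>XY\<close> covers each of them, once with the indices exchanged.\<close>
    have "expectation (\<lambda>s. ((X s + Y s) $ i - (\<mu> + \<nu>) $ i) * ((X s + Y s) $ j - (\<mu> + \<nu>) $ j)) =
        expectation (\<lambda>s. ?X i s * ?X j s + ?Y i s * ?Y j s + ?X i s * ?Y j s + ?X j s * ?Y i s)"
      using i j by (intro Bochner_Integration.integral_cong) (auto simp: algebra_simps)
    also have "\<dots> = expectation (\<lambda>s. ?X i s * ?X j s) + expectation (\<lambda>s. ?Y i s * ?Y j s) +
        expectation (\<lambda>s. ?X i s * ?Y j s) + expectation (\<lambda>s. ?X j s * ?Y i s)"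
      by (simp only: Bochner_Integration.integral_add Bochner_Integration.integrable_add XY i j
          normal_distributed_centered_integrable[OF X] normal_distributed_centered_integrable[OF Y])
    also have "\<dots> = \<Sigma> $$ (i, j) + T $$ (i, j)"
      using i j by (simp only: XY normal_distributed_cov[OF X] normal_distributed_cov[OF Y])
    finally show "(\<Sigma> + T) $$ (i, j) = ?C $$ (i, j)"
      using i j by simp
  qed auto
  ultimately show ?thesis
    using meas by (auto simp: normal_distributed_iff)
qed

end

section \<open>The law of the filtered noise\<close>

lemma normal_distributed_cong:
  assumes "\<And>s. s \<in> space M \<Longrightarrow> X s = Y s"
  shows "normal_distributed n M X \<mu> \<Sigma> \<longleftrightarrow> normal_distributed n M Y \<mu> \<Sigma>"
proof -
  have "distr M (vec_borel n) X = distr M (vec_borel n) Y"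
    using assms by (intro distr_cong) auto
  moreover have "X \<in> measurable M (vec_borel n) \<longleftrightarrow> Y \<in> measurable M (vec_borel n)"
    using assms by (rule measurable_cong)
  ultimately show ?thesis by (simp add: normal_distributed_def)
qed

lemma pow_mat_2: "A \<in> carrier_mat n n \<Longrightarrow> A ^\<^sub>m 2 = A * A"
  by (simp add: numeral_2_eq_2)

theorem mainTheorem3:
  fixes f h w N :: nat
    and F :: "complex Matrix.mat"
    and A B \<Lambda> P :: "real Matrix.mat"
    and M :: "'s measure"
    and x y z :: "'s \<Rightarrow> real Matrix.vec"
  assumes "f > 0" and "h > 0" and "w > 0" and "N = f * h * w"
    and "F = dft3_mat f h w" and "A = map_mat Re F" and "B = map_mat Im F"
    and "\<Lambda> \<in> carrier_mat N N" and "diagonal_mat \<Lambda>"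
    and "\<forall>i<N. 0 \<le> \<Lambda> $$ (i, i) \<and> \<Lambda> $$ (i, i) \<le> 1"
    and "prob_space M"
    and "prob_space.indep_var M (vec_borel N) x (vec_borel N) y"
    and "normal_distributed N M x (0\<^sub>v N) (1\<^sub>m N)"
    and "normal_distributed N M y (0\<^sub>v N) (1\<^sub>m N)"
    and "z = (\<lambda>s. map_vec Re
           ((mat_inv F * cmat \<Lambda> * F) *\<^sub>v cvec (x s) +
            (mat_inv F * cmat (1\<^sub>m N - \<Lambda>) * F) *\<^sub>v cvec (y s)))"
    and "P = (1 / real N) \<cdot>\<^sub>m (A * \<Lambda> * A + B * \<Lambda> * B)"
  shows "normal_distributed N M z (0\<^sub>v N) (P ^\<^sub>m 2 + (1\<^sub>m N - P) ^\<^sub>m 2)"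
proof -
  interpret prob_space M by fact
  have N: "N > 0" using assms(1-4) by simp
  have F: "F \<in> carrier_mat N N" using assms(4,5) by (simp add: dft3_mat_carrier)
  have F_cnj: "F * map_mat cnj F = of_nat N \<cdot>\<^sub>m 1\<^sub>m N"
    unfolding assms(4,5) by (rule dft3_mat_mult_cnj)
  \<comment> \<open>The assumptions of the context on \<open>F\<close> and \<open>P\<close>, in
    their order there, so that its facts can be instantiated.\<close>
  note filter = N F F_cnj assms(6,7,8,16)
  define Q where "Q = 1\<^sub>m N - P"
  have P: "P \<in> carrier_mat N N" and Q: "Q \<in> carrier_mat N N"
    using F assms(6,7,8,16) by (auto simp: Q_def)
  have PT: "transpose_mat P = P"
    using transpose_filter[OF filter] transpose_diagonal_mat[OF assms(8,9)]
    by (simp add: assms(5) transpose_dft3_mat)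
  have QT: "transpose_mat Q = Q"
    using P by (simp add: Q_def transpose_minus[of _ N N] PT)
  have inv: "mat_inv F \<in> carrier_mat N N"
    using F by (simp add: mat_inv_eq_cnj[OF filter])
  note x = assms(13) and y = assms(14)
  have ind: "indep_var (vec_borel N) (\<lambda>s. P *\<^sub>v x s) (vec_borel N) (\<lambda>s. Q *\<^sub>v y s)"
    using indep_var_compose[OF assms(12) measurable_mult_mat_vec[OF P] measurable_mult_mat_vec[OF Q]]
    by (simp add: comp_def)
  have "normal_distributed N M (\<lambda>s. P *\<^sub>v x s + Q *\<^sub>v y s) (P *\<^sub>v 0\<^sub>v N + Q *\<^sub>v 0\<^sub>v N)
      (P * 1\<^sub>m N * transpose_mat P + Q * 1\<^sub>m N * transpose_mat Q)"
    using normal_distributed_mult_mat_vec[OF x P] normal_distributed_mult_mat_vec[OF y Q] ind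
    by (rule normal_distributed_add)
  moreover have "P *\<^sub>v 0\<^sub>v N + Q *\<^sub>v 0\<^sub>v N = 0\<^sub>v N"
    using P Q by (intro eq_vecI) auto
  moreover have "P * 1\<^sub>m N * transpose_mat P + Q * 1\<^sub>m N * transpose_mat Q = P ^\<^sub>m 2 + Q ^\<^sub>m 2"
    using P Q by (simp add: PT QT pow_mat_2[of _ N])
  \<comment> \<open>The restriction to \<open>space M\<close> secures that \<open>x s\<close> and
    \<open>y s\<close> have dimension \<open>N\<close>, and \<open>normal_distributed_cong\<close>
    asks for equality only there.\<close>
  moreover have "z s = P *\<^sub>v x s + Q *\<^sub>v y s" if "s \<in> space M" for s
  proof -
    have xy: "x s \<in> carrier_vec N" "y s \<in> carrier_vec N"
      using that normal_distributed_carrier(3)[OF x] normal_distributed_carrier(3)[OF y] by auto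
    have "z s = map_vec Re ((mat_inv F * cmat \<Lambda> * F) *\<^sub>v cvec (x s)) +
        map_vec Re ((mat_inv F * cmat (1\<^sub>m N - \<Lambda>) * F) *\<^sub>v cvec (y s))"
      unfolding assms(15) using F inv by (intro eq_vecI) auto
    also have "\<dots> = P *\<^sub>v x s + Q *\<^sub>v y s"
      using F xy by (simp only: map_vec_Re_mult_cvec index_mult_mat carrier_matD carrier_vecD
          Re_filter[OF filter] Re_filter_compl[OF filter] Q_def)
    finally show ?thesis .
  qed
  ultimately show ?thesis
    unfolding Q_def by (subst normal_distributed_cong) auto
qed

end
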